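(* Assume that the set $\{ (x,y_1,\dots,y_m) : (x,y_1,\dots,y_m) \in G,\ y_i \in Y_i\ \forall i \in I\}$ is compact and nonempty. Assume that for each $i \in I$, $g_i$ is continuous and $Y_i$ is compact. Let $\epsilon^* = \limsup_{k\to\infty} \epsilon^k$ and $\eta_i^* = \limsup_{k\to\infty} \eta_i^k$ for each $i \in I$. Then for any $\varepsilon > \epsilon^* + 2\sum_{i\in I} \eta_i^*$, Algorithm A (described in the context), run with tolerance $\varepsilon$, terminates after finitely many iterations and returns an $\varepsilon$-optimal solution $(x^*,y^* )$ of the minimum disequilibrium problem; that is, $(x^*,y^* ) \in G$, $y_i^* \in Y_i$ for each $i \in I$, and $\sum_{i\in I} \bigl(g_i(x^*,y_i^* ) - g_i^*(x^* )\bigr) \le \delta + \varepsilon$.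
   Context: Let $I = \{1,\dots,m\}$. For each $i \in I$ let $Y_i \subset \mathbb{R}^{n_i}$ and $g_i : \mathbb{R}^{n_0} \times Y_i \to \mathbb{R}$, and let $G \subset \mathbb{R}^{n_0} \times \mathbb{R}^{n_1} \times \dots \times \mathbb{R}^{n_m}$. Write $y = (y_1,\dots,y_m)$ and $w=(w_1,\dots,w_m)$. Define $g_i^*(x) = \inf \{ g_i(x,z_i) : z_i \in Y_i\}$. The minimum disequilibrium problem is $$ \delta = \inf_{x,y,w} \sum_{i\in I} (g_i(x,y_i) - w_i) \quad \text{s.t.}\quad (x,y_1,\dots,y_m)\in G,\quad y_i \in Y_i,\quad w_i \le g_i^*(x)\quad \forall i \in I, $$ with $w \in \mathbb{R}^m$. Algorithm A. Inputs: a tolerance $\varepsilon > 0$; for each $i \in I$ an arbitrary nonempty initial subset $Y_i^{L,1} \subset Y_i$; nonnegative real sequences $(\epsilon^k)_{k\ge 1}$ and $(\eta_i^k)_{k \ge 1}$, $i \in I$. Initialize $\delta^{U,0} = +\infty$ and $\delta^{L,0} = 0$. For $k = 1,2,3,\dots$ do: 1. (Lower bounding problem) Consider $$ \underline{\delta}^k := \inf_{x,y,w} \sum_{i\in I}(g_i(x,y_i) - w_i) \quad \text{s.t.}\quad (x,y_1,\dots,y_m)\in G,\quad y_i\in Y_i\ \forall i \in I,\quad w_i \le g_i(x,z_i)\ \ \forall z_i \in Y_i^{L,k},\ \forall i\in I . $$ Solve it approximately, obtaining any feasible point $(x^k,y^k,w^k)$ with objective value $\bar\delta^{L,k} = \sum_{i\in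 I}(g_i(x^k,y_i^k) - w_i^k)$ and any lower bound $\underline{\delta}^{L,k} \le \underline{\delta}^k$ such that $|\bar\delta^{L,k} - \underline{\delta}^{L,k}| \le \epsilon^k$. 2. Set $\delta^{L,k} = \max\{\underline{\delta}^{L,k}, \delta^{L,k-1}\}$. 3. (Player problems) For each $i\in I$, approximately solve $g_i^*(x^k) = \inf\{ g_i(x^k,z_i) : z_i \in Y_i\}$, obtaining any feasible $z_i^k \in Y_i$ and any lower bound $g_i^{L,k} \le g_i^*(x^k)$ such that $|g_i(x^k,z_i^k) - g_i^{L,k}| \le \eta_i^k$. 4. If $\epsilon^k \le \varepsilon$ and $w_i^k \le g_i^{L,k}$ for all $i\in I$, set $(x^*,y^* ) = (x^k,y^k)$, return $(x^*,y^* )$ and terminate. 5. Set $Y_i^{L,k+1} = Y_i^{L,k} \cup \{z_i^k\}$ for each $i \in I$. 6. Set $\bar\delta^{U,k} = \sum_{i\in I}(g_i(x^k,y_i^k) - g_i^{L,k})$ and $\delta^{U,k} = \min\{\bar\delta^{U,k}, \delta^{U,k-1}\}$. If $\bar\delta^{U,k} < \delta^{U,k-1}$, set $(x^*,y^* ) = (x^k,y^k)$. 7. If $\delta^{U,k} - \delta^{L,k} \le \varepsilon$, return $(x^*,y^* )$ and terminate. *)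

theory Defs
  imports "HOL-Analysis.Analysis"
begin

text \<open>
  Points of R^d are elements of \<^term>\<open>topspace (Euclidean_space d)\<close>, i.e. real sequences that
  vanish from index \<open>d\<close> on; this allows a different dimension for each player.  A strategy
  profile \<open>y = (y_1, ..., y_m)\<close> is a function in \<open>\<Pi>\<^sub>E i\<in>{1..m}. topspace (Euclidean_space (n i))\<close>,
  and \<open>w \<in> R^m\<close> is a function in \<^term>\<open>extensional {1..m}\<close>.  The functions \<open>g i\<close> are only ever
  used on \<open>R^(n0) \<times> Y i\<close>.  Infima are taken in the extended reals, so that they have their usual
  meaning for empty and for unbounded sets of values.
\<close>

type_synonym point = "nat \<Rightarrow> real"
type_synonym profile = "nat \<Rightarrow> point"

definition gstar :: "(nat \<Rightarrow> point set) \<Rightarrow> (nat \<Rightarrow> point \<Rightarrow> point \<Rightarrow> real) \<Rightarrow> nat \<Rightarrow> point \<Rightarrow> ereal" where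
  "gstar Y g i x = (INF z\<in>Y i. ereal (g i x z))"

definition joint_strategies ::
  "nat \<Rightarrow> (nat \<Rightarrow> point set) \<Rightarrow> (point \<times> profile) set \<Rightarrow> (point \<times> profile) set" where
  "joint_strategies m Y G = {(x, y). (x, y) \<in> G \<and> (\<forall>i\<in>{1..m}. y i \<in> Y i)}"

definition disequilibrium ::
  "nat \<Rightarrow> (nat \<Rightarrow> point \<Rightarrow> point \<Rightarrow> real) \<Rightarrow> point \<times> profile \<times> (nat \<Rightarrow> real) \<Rightarrow> real" where
  "disequilibrium m g = (\<lambda>(x, y, w). \<Sum>i\<in>{1..m}. (g i x (y i) - w i))"

definition feasible ::
  "nat \<Rightarrow> (nat \<Rightarrow> point set) \<Rightarrow> (nat \<Rightarrow> point \<Rightarrow> point \<Rightarrow> real) \<Rightarrow> (point \<times> profile) set \<Rightarrow>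
    (point \<times> profile \<times> (nat \<Rightarrow> real)) set" where
  "feasible m Y g G = {(x, y, w). (x, y) \<in> joint_strategies m Y G \<and> w \<in> extensional {1..m} \<and>
     (\<forall>i\<in>{1..m}. ereal (w i) \<le> gstar Y g i x)}"

definition min_disequilibrium ::
  "nat \<Rightarrow> (nat \<Rightarrow> point set) \<Rightarrow> (nat \<Rightarrow> point \<Rightarrow> point \<Rightarrow> real) \<Rightarrow> (point \<times> profile) set \<Rightarrow> ereal" where
  "min_disequilibrium m Y g G = (INF p\<in>feasible m Y g G. ereal (disequilibrium m g p))"

definition eps_optimal ::
  "nat \<Rightarrow> (nat \<Rightarrow> point set) \<Rightarrow> (nat \<Rightarrow> point \<Rightarrow> point \<Rightarrow> real) \<Rightarrow> (point \<times> profile) set \<Rightarrow> real \<Rightarrow>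
    point \<Rightarrow> profile \<Rightarrow> bool" where
  "eps_optimal m Y g G \<epsilon> x y \<longleftrightarrow> (x, y) \<in> G \<and> (\<forall>i\<in>{1..m}. y i \<in> Y i) \<and>
     (\<Sum>i\<in>{1..m}. ereal (g i x (y i)) - gstar Y g i x) \<le> min_disequilibrium m Y g G + ereal \<epsilon>"

definition lower_feasible ::
  "nat \<Rightarrow> (nat \<Rightarrow> point set) \<Rightarrow> (nat \<Rightarrow> point \<Rightarrow> point \<Rightarrow> real) \<Rightarrow> (point \<times> profile) set \<Rightarrow>
    (nat \<Rightarrow> point set) \<Rightarrow> (point \<times> profile \<times> (nat \<Rightarrow> real)) set" where
  "lower_feasible m Y g G YL = {(x, y, w). (x, y) \<in> joint_strategies m Y G \<and>
     w \<in> extensional {1..m} \<and> (\<forall>i\<in>{1..m}. \<forall>z\<in>YL i. w i \<le> g i x z)}"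

definition lower_value ::
  "nat \<Rightarrow> (nat \<Rightarrow> point set) \<Rightarrow> (nat \<Rightarrow> point \<Rightarrow> point \<Rightarrow> real) \<Rightarrow> (point \<times> profile) set \<Rightarrow>
    (nat \<Rightarrow> point set) \<Rightarrow> ereal" where
  "lower_value m Y g G YL = (INF p\<in>lower_feasible m Y g G YL. ereal (disequilibrium m g p))"

text \<open>
  A configuration \<open>Running k YL dL dU inc\<close> is the state at the start of iteration \<open>k\<close>: the current
  discretizations, the bounds from iteration \<open>k - 1\<close>, and the incumbent (\<open>None\<close> as long as none
  has been assigned).
\<close>

datatype config =
    Running nat "nat \<Rightarrow> point set" real ereal "(point \<times> profile) option"
  | Returned "(point \<times> profile) option"

definition initial_config :: "(nat \<Rightarrow> point set) \<Rightarrow> config" where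
  "initial_config YL1 = Running 1 YL1 0 \<infinity> None"

definition lower_answer ::
  "nat \<Rightarrow> (nat \<Rightarrow> point set) \<Rightarrow> (nat \<Rightarrow> point \<Rightarrow> point \<Rightarrow> real) \<Rightarrow> (point \<times> profile) set \<Rightarrow>
    (nat \<Rightarrow> point set) \<Rightarrow> real \<Rightarrow> point \<times> profile \<times> (nat \<Rightarrow> real) \<Rightarrow> real \<Rightarrow> bool" where
  "lower_answer m Y g G YL tol p lb \<longleftrightarrow> p \<in> lower_feasible m Y g G YL \<and>
     ereal lb \<le> lower_value m Y g G YL \<and> \<bar>disequilibrium m g p - lb\<bar> \<le> tol"

definition player_answer ::
  "(nat \<Rightarrow> point set) \<Rightarrow> (nat \<Rightarrow> point \<Rightarrow> point \<Rightarrow> real) \<Rightarrow> nat \<Rightarrow> point \<Rightarrow> real \<Rightarrow>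
    point \<Rightarrow> real \<Rightarrow> bool" where
  "player_answer Y g i x tol z gL \<longleftrightarrow> z \<in> Y i \<and> ereal gL \<le> gstar Y g i x \<and> \<bar>g i x z - gL\<bar> \<le> tol"

text \<open>
  The next configuration once the subproblems have been answered: \<open>(x, y, w)\<close> and \<open>lb\<close> for the
  lower bounding problem, \<open>z i\<close> and \<open>gL i\<close> for player \<open>i\<close>; \<open>tol\<close> is the accuracy requested for the
  lower bounding problem.
\<close>

definition next_config ::
  "nat \<Rightarrow> (nat \<Rightarrow> point \<Rightarrow> point \<Rightarrow> real) \<Rightarrow> real \<Rightarrow> real \<Rightarrow>
    nat \<Rightarrow> (nat \<Rightarrow> point set) \<Rightarrow> real \<Rightarrow> ereal \<Rightarrow> (point \<times> profile) option \<Rightarrow>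
    point \<Rightarrow> profile \<Rightarrow> (nat \<Rightarrow> real) \<Rightarrow> real \<Rightarrow> profile \<Rightarrow> (nat \<Rightarrow> real) \<Rightarrow> config" where
  "next_config m g \<epsilon> tol k YL dL dU inc x y w lb z gL =
    (let dL' = max lb dL;
         ub = (\<Sum>i\<in>{1..m}. (g i x (y i) - gL i));
         dU' = min (ereal ub) dU;
         inc' = (if ereal ub < dU then Some (x, y) else inc)
     in if tol \<le> \<epsilon> \<and> (\<forall>i\<in>{1..m}. w i \<le> gL i) then Returned (Some (x, y))
        else if dU' - ereal dL' \<le> ereal \<epsilon> then Returned inc'
        else Running (Suc k) (\<lambda>i. YL i \<union> {z i}) dL' dU' inc')"

text \<open>One iteration of the algorithm; nondeterministic, as any admissible answers may be obtained.\<close>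

inductive iteration ::
  "nat \<Rightarrow> (nat \<Rightarrow> point set) \<Rightarrow> (nat \<Rightarrow> point \<Rightarrow> point \<Rightarrow> real) \<Rightarrow> (point \<times> profile) set \<Rightarrow> real \<Rightarrow>
    (nat \<Rightarrow> real) \<Rightarrow> (nat \<Rightarrow> nat \<Rightarrow> real) \<Rightarrow> config \<Rightarrow> config \<Rightarrow> bool"
  for m Y g G \<epsilon> e \<eta> where
  "\<lbrakk>lower_answer m Y g G YL (e k) (x, y, w) lb;
    \<forall>i\<in>{1..m}. player_answer Y g i x (\<eta> i k) (z i) (gL i)\<rbrakk>
   \<Longrightarrow> iteration m Y g G \<epsilon> e \<eta> (Running k YL dL dU inc)
        (next_config m g \<epsilon> (e k) k YL dL dU inc x y w lb z gL)"

text \<open>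
  Total correctness of a nondeterministic program: no execution is infinite, and every execution
  that cannot be continued has returned an assigned point that satisfies \<open>Q\<close> (in particular, no
  execution gets stuck in a \<open>Running\<close> configuration).
\<close>

definition terminates_returning ::
  "(config \<Rightarrow> config \<Rightarrow> bool) \<Rightarrow> config \<Rightarrow> (point \<Rightarrow> profile \<Rightarrow> bool) \<Rightarrow> bool" where
  "terminates_returning step c0 Q \<longleftrightarrow>
     (\<nexists>c. c 0 = c0 \<and> (\<forall>j. step (c j) (c (Suc j)))) \<and>
     (\<forall>c. step\<^sup>*\<^sup>* c0 c \<and> (\<nexists>c'. step c c') \<longrightarrow> (\<exists>x y. c = Returned (Some (x, y)) \<and> Q x y))"

end

theory Submission
  imports Defs
begin

text \<open>
  Write \<open>J\<close> for the compact set of joint strategies and \<open>\<delta>\<close> for the minimum disequilibrium.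

  The value of the algorithm is sandwiched throughout. Replacing \<open>Y i\<close> by a subset only drops
  constraints on \<open>w\<close>, so every lower bounding problem is a relaxation and the recorded lower bound
  never exceeds \<open>\<delta>\<close>; the bounds obtained from the player problems lie below \<open>gstar\<close>, so the
  recorded upper bound dominates the true disequilibrium of the incumbent. Either way of stopping
  then certifies \<open>\<epsilon>\<close>-optimality. This is the invariant \<open>sound\<close>, preserved by \<open>sound_step\<close>.

  No execution gets stuck. The tolerances may be zero, so this needs exact solutions of the
  subproblems. For a player it is a continuous function on a compact set. For the lower bounding
  problem the discretizations are arbitrary sets, but with the optimal choice of \<open>w\<close> the objective
  is a supremum of continuous functions of \<open>(x, y)\<close>, hence lower semicontinuous, and so attains its
  minimum on \<open>J\<close> (\<open>lower_solvable\<close>).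

  No execution is infinite. In iteration \<open>l\<close> the lower bounding problem already contains the cuts
  \<open>w i \<le> g i x (z k i)\<close> from all earlier iterations \<open>k\<close>. If player \<open>i\<close>'s answer \<open>z l i\<close> still
  undercut \<open>w i\<close> by more than a fixed amount \<open>c > 0\<close>, then \<open>g i x\<close> would differ by more than \<open>c\<close> at
  \<open>z l i\<close> and at every earlier \<open>z k i\<close>, so by uniform continuity these points would be a fixed
  distance apart. A compact set has no room for infinitely many such points
  (\<open>discretization_eventually_accurate\<close>). Hence eventually the gap between the upper and lower bounds
  of an iteration exceeds \<open>e + (\<Sum>i. \<eta> i)\<close> by an arbitrarily small amount only, and since the
  tolerances are eventually below some \<open>b < \<epsilon>\<close>, the stopping test succeeds.
\<close>

section \<open>Compactness\<close>

text \<open>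
  If the minimum were not attained, every point \<open>p\<close> would have a better point \<open>t p\<close>, and the open sets
  where \<open>f\<close> exceeds \<open>f (t p)\<close> would cover the space. The best of the points \<open>t c\<close> belonging to a
  finite subcover lies in none of its sets.
\<close>
lemma lower_semicontinuous_attains_min:
  fixes f :: "'a \<Rightarrow> 'b::linorder"
  assumes "compact_space X" "topspace X \<noteq> {}"
    and lsc: "\<And>a. openin X {p \<in> topspace X. a < f p}"
  obtains p where "p \<in> topspace X" "\<And>q. q \<in> topspace X \<Longrightarrow> f p \<le> f q"
proof -
  have "\<exists>p\<in>topspace X. \<forall>q\<in>topspace X. f p \<le> f q"
  proof (rule ccontr)
    assume "\<not> ?thesis"
    then have "\<forall>p\<in>topspace X. \<exists>q\<in>topspace X. f q < f p"
      by (meson not_le)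
    then obtain t where t: "\<And>p. p \<in> topspace X \<Longrightarrow> t p \<in> topspace X \<and> f (t p) < f p"
      by metis
    let ?U = "\<lambda>c. {p \<in> topspace X. f (t c) < f p}"
    have "topspace X \<subseteq> \<Union> (?U ` topspace X)"
      using t by auto
    moreover have "\<forall>U \<in> ?U ` topspace X. openin X U"
      using lsc by auto
    ultimately obtain \<F> where "finite \<F>" "\<F> \<subseteq> ?U ` topspace X" "topspace X \<subseteq> \<Union>\<F>"
      using assms(1) unfolding compact_space_alt by meson
    then obtain C where C: "finite C" "C \<subseteq> topspace X" "topspace X \<subseteq> \<Union> (?U ` C)"
      using finite_subset_image[of \<F> ?U "topspace X"] by blast
    then have "C \<noteq> {}"
      using assms(2) by auto
    then obtain c where c: "c \<in> C" "\<And>d. d \<in> C \<Longrightarrow> f (t c) \<le> f (t d)"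
      using ex_is_arg_min_if_finite[OF C(1), of "\<lambda>c. f (t c)"] by (auto simp: is_arg_min_linorder)
    then have "t c \<in> \<Union> (?U ` C)"
      using C t by blast
    then show False
      using c(2) by (auto simp: not_le[symmetric])
  qed
  then show thesis
    using that by blast
qed

lemma no_separated_sequence_in_compact:
  fixes z :: "nat \<Rightarrow> 'a::metric_space"
  assumes "compact S" "\<And>k. z k \<in> S" "0 < d" "infinite L"
    and sep: "\<And>k l. l \<in> L \<Longrightarrow> k < l \<Longrightarrow> k \<in> L \<Longrightarrow> d \<le> dist (z k) (z l)"
  shows False
proof -
  define r where "r = enumerate L"
  have r: "strict_mono r" "\<And>j. r j \<in> L"
    using \<open>infinite L\<close> by (auto simp: r_def strict_mono_enumerate enumerate_in_set)
  obtain a s where s: "strict_mono s" "((z \<circ> r) \<circ> s) \<longlonglongrightarrow> a"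
    using \<open>compact S\<close> assms(2) unfolding compact_def by (metis comp_apply)
  then have "Cauchy ((z \<circ> r) \<circ> s)"
    by (simp add: LIMSEQ_imp_Cauchy)
  then obtain N where N: "\<And>i j. i \<ge> N \<Longrightarrow> j \<ge> N \<Longrightarrow> dist (z (r (s i))) (z (r (s j))) < d"
    using \<open>0 < d\<close> unfolding Cauchy_def comp_def by metis
  have "r (s N) < r (s (Suc N))"
    using r(1) s(1) by (simp add: strict_mono_less)
  then show False
    using sep[OF r(2)] r(2) N[of N "Suc N"] by (force simp: not_less[symmetric])
qed

text \<open>
  The abstract convergence mechanism of the algorithm: \<open>z k\<close> is the answer of a player in round \<open>k\<close>,
  and in round \<open>l\<close> the value \<open>w l\<close> satisfies the cuts produced by all previous answers. Each round in
  which the new answer violates \<open>w l\<close> by more than \<open>c\<close> puts \<open>z l\<close> at a uniform distance from all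
  earlier answers, so there are only finitely many of them. The points \<open>x l\<close> range over a compact set
  to make that distance independent of the round.
\<close>
lemma discretization_eventually_accurate:
  fixes f :: "'a::metric_space \<Rightarrow> 'b::metric_space \<Rightarrow> real"
  assumes "compact K" "compact S" "continuous_on (K \<times> S) (\<lambda>(x, z). f x z)"
    and xK: "\<And>k. x k \<in> K" and zS: "\<And>k. z k \<in> S"
    and cut: "\<And>k l. k < l \<Longrightarrow> w l \<le> f (x l) (z k)"
    and "0 < c"
  shows "\<forall>\<^sub>F l in sequentially. w l \<le> f (x l) (z l) + c"
proof (rule ccontr)
  define L where "L = {l. f (x l) (z l) + c < w l}"
  assume "\<not> ?thesis"
  then have "infinite L"
    by (simp add: L_def not_eventually not_le frequently_cofinite[symmetric] cofinite_eq_sequentially)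
  have "uniformly_continuous_on (K \<times> S) (\<lambda>(x, z). f x z)"
    using assms(1-3) by (intro compact_uniformly_continuous compact_Times)
  then obtain d where "0 < d" and
    d: "\<And>p q. p \<in> K \<times> S \<Longrightarrow> q \<in> K \<times> S \<Longrightarrow> dist q p < d \<Longrightarrow>
          dist (case q of (x, z) \<Rightarrow> f x z) (case p of (x, z) \<Rightarrow> f x z) < c"
    using \<open>0 < c\<close> unfolding uniformly_continuous_on_def by meson
  have sep: "d \<le> dist (z k) (z l)" if "l \<in> L" "k < l" for k l
  proof (rule ccontr)
    assume "\<not> d \<le> dist (z k) (z l)"
    then have "\<bar>f (x l) (z k) - f (x l) (z l)\<bar> < c"
      using d[of "(x l, z l)" "(x l, z k)"] xK zS by (auto simp: dist_Pair_Pair dist_real_def)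
    then show False
      using cut[OF \<open>k < l\<close>] \<open>l \<in> L\<close> by (auto simp: L_def)
  qed
  show False
    by (rule no_separated_sequence_in_compact[OF \<open>compact S\<close> zS \<open>0 < d\<close> \<open>infinite L\<close> sep])
qed

lemma limsup_sum_le:
  fixes u :: "'i \<Rightarrow> nat \<Rightarrow> ereal"
  shows "limsup (\<lambda>k. \<Sum>i\<in>I. u i k) \<le> (\<Sum>i\<in>I. limsup (u i))"
proof (induction I rule: infinite_finite_induct)
  case (insert i I)
  have "limsup (\<lambda>k. u i k + (\<Sum>i\<in>I. u i k)) \<le> limsup (u i) + limsup (\<lambda>k. \<Sum>i\<in>I. u i k)"
    by (rule ereal_limsup_add_mono)
  also have "\<dots> \<le> limsup (u i) + (\<Sum>i\<in>I. limsup (u i))"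
    using insert.IH by (rule add_left_mono)
  finally show ?case
    using insert.hyps by simp
qed (auto simp: Limsup_const)

section \<open>The problem and its relaxations\<close>

locale compact_disequilibrium =
  fixes m n0 :: nat and n :: "nat \<Rightarrow> nat"
    and Y :: "nat \<Rightarrow> point set"
    and g :: "nat \<Rightarrow> point \<Rightarrow> point \<Rightarrow> real"
    and G :: "(point \<times> profile) set"
  assumes G_subset: "G \<subseteq> topspace (Euclidean_space n0) \<times>
                          (\<Pi>\<^sub>E i\<in>{1..m}. topspace (Euclidean_space (n i)))"
    and joint_compact:
      "compactin (prod_topology (Euclidean_space n0)
                   (product_topology (\<lambda>i. Euclidean_space (n i)) {1..m}))
                 (joint_strategies m Y G)"
    and joint_nonempty: "joint_strategies m Y G \<noteq> {}"
    and Y_compact: "\<And>i. i \<in> {1..m} \<Longrightarrow> compactin (Euclidean_space (n i)) (Y i)"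
    and g_continuous:
      "\<And>i. i \<in> {1..m} \<Longrightarrow>
         continuous_map (prod_topology (Euclidean_space n0)
                           (subtopology (Euclidean_space (n i)) (Y i)))
                        euclideanreal (\<lambda>(x, z). g i x z)"
begin

abbreviation "J \<equiv> joint_strategies m Y G"
abbreviation "\<delta> \<equiv> min_disequilibrium m Y g G"

text \<open>
  The type of real sequences carries the product topology, so each \<open>R^d\<close> is an ordinary subspace of
  one metric space, and the metric notions of compactness and uniform continuity apply.
\<close>
lemma Euclidean_space_eq: "Euclidean_space d = top_of_set (topspace (Euclidean_space d))"
  by (simp add: Euclidean_space_def euclidean_product_topology)

lemma Y_props:
  assumes "i \<in> {1..m}"
  shows "compact (Y i)" "Y i \<subseteq> topspace (Euclidean_space (n i))"
  using Y_compact[OF assms] Euclidean_space_eq[of "n i"]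
  by (metis compactin_euclidean_iff compactin_subtopology, metis compactin_subset_topspace)

lemma g_continuous_on:
  assumes "i \<in> {1..m}"
  shows "continuous_on (topspace (Euclidean_space n0) \<times> Y i) (\<lambda>(x, z). g i x z)"
proof -
  have "subtopology (Euclidean_space (n i)) (Y i) = top_of_set (Y i)"
    using Y_props(2)[OF assms] Euclidean_space_eq[of "n i"]
    by (metis inf.absorb_iff2 subtopology_subtopology)
  then show ?thesis
    using g_continuous[OF assms] Euclidean_space_eq[of n0]
    by (metis continuous_map_iff_continuous prod_topology_subtopology_eu)
qed

lemma joint_strategiesD:
  assumes "(x, y) \<in> J"
  shows "(x, y) \<in> G" "x \<in> topspace (Euclidean_space n0)" "\<And>i. i \<in> {1..m} \<Longrightarrow> y i \<in> Y i"
  using assms G_subset by (auto simp: joint_strategies_def)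

lemma compact_leader: "compact (fst ` J)"
proof -
  have "compactin (Euclidean_space n0) (fst ` J)"
    using joint_compact continuous_map_fst by (rule image_compactin)
  then show ?thesis
    using Euclidean_space_eq[of n0] by (metis compactin_euclidean_iff compactin_subtopology)
qed

lemma g_minimizer:
  assumes "i \<in> {1..m}" "x \<in> topspace (Euclidean_space n0)" "Y i \<noteq> {}"
  obtains z where "z \<in> Y i" "\<And>z'. z' \<in> Y i \<Longrightarrow> g i x z \<le> g i x z'"
proof -
  have "continuous_on (Y i) ((\<lambda>(x, z). g i x z) \<circ> (\<lambda>z. (x, z)))"
    using assms(2) by (intro continuous_on_compose continuous_intros
        continuous_on_subset[OF g_continuous_on[OF assms(1)]]) auto
  then show thesis
    using that continuous_attains_inf[OF Y_props(1)[OF assms(1)] assms(3)] by fastforce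
qed

lemma player_solvable:
  assumes "i \<in> {1..m}" "x \<in> topspace (Euclidean_space n0)" "Y i \<noteq> {}" "0 \<le> tol"
  shows "\<exists>z gL. player_answer Y g i x tol z gL"
proof -
  obtain z where z: "z \<in> Y i" "\<And>z'. z' \<in> Y i \<Longrightarrow> g i x z \<le> g i x z'"
    using g_minimizer[OF assms(1-3)] by blast
  then have "player_answer Y g i x tol z (g i x z)"
    using assms(4) by (auto simp: player_answer_def gstar_def intro: INF_greatest)
  then show ?thesis
    by blast
qed

text \<open>
  For a fixed profile \<open>\<zeta>\<close> of responses, the total gain of deviating from \<open>y\<close> to \<open>\<zeta>\<close>. The optimal value
  of the lower bounding problem at \<open>(x, y)\<close> is the supremum of these gains over all \<open>\<zeta>\<close> in the
  discretization.
\<close>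
lemma gain_continuous:
  assumes "\<And>i. i \<in> {1..m} \<Longrightarrow> \<zeta> i \<in> Y i"
  shows "continuous_map (subtopology (prod_topology (Euclidean_space n0)
            (product_topology (\<lambda>i. Euclidean_space (n i)) {1..m})) J) euclideanreal
          (\<lambda>p. \<Sum>i\<in>{1..m}. g i (fst p) (snd p i) - g i (fst p) (\<zeta> i))"
proof (intro continuous_map_sum continuous_map_diff)
  let ?T = "subtopology (prod_topology (Euclidean_space n0)
            (product_topology (\<lambda>i. Euclidean_space (n i)) {1..m})) J"
  fix i assume i: "i \<in> {1..m}"
  have via: "continuous_map ?T euclideanreal (\<lambda>p. g i (fst p) (v p))"
    if "continuous_map ?T (Euclidean_space (n i)) v" "\<And>p. p \<in> J \<Longrightarrow> v p \<in> Y i" for v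
  proof -
    have "continuous_map ?T (prod_topology (Euclidean_space n0)
        (subtopology (Euclidean_space (n i)) (Y i))) (\<lambda>p. (fst p, v p))"
      using that by (intro continuous_map_pairedI)
        (auto simp: continuous_map_in_subtopology continuous_map_from_subtopology continuous_map_fst)
    from continuous_map_compose[OF this g_continuous[OF i]] show ?thesis
      by (simp add: comp_def)
  qed
  have "continuous_map ?T (Euclidean_space (n i)) (\<lambda>p. snd p i)"
    using continuous_map_compose[OF continuous_map_snd continuous_map_product_projection[OF i]]
    by (auto simp: comp_def intro: continuous_map_from_subtopology)
  then show "continuous_map ?T euclideanreal (\<lambda>p. g i (fst p) (snd p i))"
    using joint_strategiesD(3)[OF _ i] by (intro via) auto
  show "continuous_map ?T euclideanreal (\<lambda>p. g i (fst p) (\<zeta> i))"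
    using assms[OF i] Y_props(2)[OF i] by (intro via) auto
qed auto

text \<open>
  Eliminating \<open>w\<close>, whose best value at \<open>x\<close> is the infimum \<open>W\<close> of \<open>g i x\<close> over the discretization,
  leaves the function \<open>F\<close> to be minimized over \<open>J\<close>. The infimum \<open>W\<close> need not be attained, but \<open>F\<close> is the
  supremum of the continuous gains \<open>h \<zeta>\<close>; this makes its strict superlevel sets unions of open sets.
\<close>
lemma lower_solvable:
  assumes YL: "\<And>i. i \<in> {1..m} \<Longrightarrow> YL i \<noteq> {} \<and> YL i \<subseteq> Y i" and "0 \<le> tol"
  shows "\<exists>x y w lb. lower_answer m Y g G YL tol (x, y, w) lb"
proof -
  define W where "W i x = Inf (g i x ` YL i)" for i x
  define F where "F p = (\<Sum>i\<in>{1..m}. g i (fst p) (snd p i) - W i (fst p))" for p :: "point \<times> profile"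
  let ?T = "subtopology (prod_topology (Euclidean_space n0)
            (product_topology (\<lambda>i. Euclidean_space (n i)) {1..m})) J"
  have top: "topspace ?T = J"
    using compactin_subset_topspace[OF joint_compact] by (simp add: Int_absorb1)
  have bdd: "bdd_below (g i x ` YL i)" if "i \<in> {1..m}" "x \<in> topspace (Euclidean_space n0)" for i x
    using g_minimizer[OF that] YL[OF that(1)] by (metis bdd_below.I2 subset_empty subset_iff)
  have W_le: "W i x \<le> g i x z"
    if "i \<in> {1..m}" "x \<in> topspace (Euclidean_space n0)" "z \<in> YL i" for i x z
    unfolding W_def using bdd[OF that(1,2)] that(3) by (intro cInf_lower) auto
  define Z where "Z = (\<Pi> i\<in>{1..m}. YL i)"
  define h where "h \<zeta> p = (\<Sum>i\<in>{1..m}. g i (fst p) (snd p i) - g i (fst p) (\<zeta> i))"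
    for \<zeta> and p :: "point \<times> profile"
  have F_h: "a < F p \<longleftrightarrow> (\<exists>\<zeta>\<in>Z. a < h \<zeta> p)" if "p \<in> J" for a p
  proof
    have x: "fst p \<in> topspace (Euclidean_space n0)"
      using joint_strategiesD(2)[of "fst p" "snd p"] that by simp
    {
      assume "\<exists>\<zeta>\<in>Z. a < h \<zeta> p"
      then obtain \<zeta> where \<zeta>: "\<zeta> \<in> Z" "a < h \<zeta> p"
        by blast
      have "h \<zeta> p \<le> F p"
        unfolding h_def F_def using \<zeta>(1) W_le[OF _ x] by (intro sum_mono) (auto simp: Z_def Pi_iff)
      then show "a < F p"
        using \<zeta>(2) by simp
    next
      assume a: "a < F p"
      \<comment> \<open>Slack per player so small that \<open>m\<close> slacks do not use up \<open>F p - a\<close>; the \<open>+ 1\<close> covers \<open>m = 0\<close>.\<close>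
      define s where "s = (F p - a) / (real m + 1)"
      have s: "0 < s" "a < F p - real m * s"
        using a by (auto simp: s_def field_simps)
      have "\<exists>z\<in>YL i. g i (fst p) z < W i (fst p) + s" if "i \<in> {1..m}" for i
        using cInf_lessD[of "g i (fst p) ` YL i" "W i (fst p) + s"] YL[OF that] s(1)
        by (auto simp: W_def)
      then obtain \<zeta> where \<zeta>: "\<And>i. i \<in> {1..m} \<Longrightarrow> \<zeta> i \<in> YL i \<and> g i (fst p) (\<zeta> i) < W i (fst p) + s"
        by metis
      have "F p - real m * s = (\<Sum>i\<in>{1..m}. g i (fst p) (snd p i) - W i (fst p) - s)"
        unfolding F_def by (simp add: sum_subtractf)
      also have "\<dots> \<le> h \<zeta> p"
        unfolding h_def using \<zeta> by (intro sum_mono) (smt (verit))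
      finally show "\<exists>\<zeta>\<in>Z. a < h \<zeta> p"
        using s(2) \<zeta> by (intro bexI[of _ \<zeta>]) (auto simp: Z_def)
    }
  qed
  have "openin ?T {p \<in> topspace ?T. a < F p}" for a
  proof -
    have "{p \<in> topspace ?T. a < F p} = (\<Union>\<zeta>\<in>Z. {p \<in> topspace ?T. a < h \<zeta> p})"
      unfolding top using F_h by auto
    moreover have "openin ?T {p \<in> topspace ?T. a < h \<zeta> p}" if "\<zeta> \<in> Z" for \<zeta>
      using gain_continuous[of \<zeta>] that YL unfolding h_def Z_def
        continuous_map_upper_lower_semicontinuous_lt by blast
    ultimately show ?thesis
      by auto
  qed
  then obtain p where p: "p \<in> J" "\<And>q. q \<in> J \<Longrightarrow> F p \<le> F q"
    using lower_semicontinuous_attains_min[of ?T F] compact_space_subtopology[OF joint_compact]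
      joint_nonempty unfolding top by metis
  obtain x y where xy: "p = (x, y)"
    by fastforce
  define w where "w = restrict (\<lambda>i. W i x) {1..m}"
  have w: "(x, y, w) \<in> lower_feasible m Y g G YL" "disequilibrium m g (x, y, w) = F p"
    using p(1) W_le joint_strategiesD(2)
    by (auto simp: lower_feasible_def disequilibrium_def w_def F_def xy)
  have "ereal (F p) \<le> lower_value m Y g G YL"
    unfolding lower_value_def
  proof (rule INF_greatest)
    fix q assume "q \<in> lower_feasible m Y g G YL"
    then obtain x' y' w' where q: "q = (x', y', w')" "(x', y') \<in> J"
      "\<And>i z. i \<in> {1..m} \<Longrightarrow> z \<in> YL i \<Longrightarrow> w' i \<le> g i x' z"
      by (auto simp: lower_feasible_def)
    have "F (x', y') \<le> disequilibrium m g q"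
      unfolding F_def disequilibrium_def q(1) W_def
      using q(3) YL by (auto intro!: sum_mono cInf_greatest)
    then show "ereal (F p) \<le> ereal (disequilibrium m g q)"
      using p(2)[OF q(2)] by simp
  qed
  then have "lower_answer m Y g G YL tol (x, y, w) (F p)"
    using w \<open>0 \<le> tol\<close> by (simp add: lower_answer_def)
  then show ?thesis
    by blast
qed

lemma lower_value_le:
  assumes "\<And>i. i \<in> {1..m} \<Longrightarrow> YL i \<subseteq> Y i"
  shows "lower_value m Y g G YL \<le> \<delta>"
  unfolding lower_value_def min_disequilibrium_def
proof (rule INF_superset_mono)
  show "feasible m Y g G \<subseteq> lower_feasible m Y g G YL"
    using assms
    by (force simp: feasible_def lower_feasible_def gstar_def le_INF_iff)
qed simp

text \<open>
  Every player can respond with the strategy \<open>y i\<close> itself. This justifies the initial lower bound \<open>0\<close>.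
\<close>
lemma min_disequilibrium_nonneg: "0 \<le> \<delta>"
  unfolding min_disequilibrium_def
proof (rule INF_greatest)
  fix p assume "p \<in> feasible m Y g G"
  then have "0 \<le> disequilibrium m g p"
    by (force simp: feasible_def disequilibrium_def gstar_def le_INF_iff joint_strategies_def
        intro: sum_nonneg)
  then show "0 \<le> ereal (disequilibrium m g p)"
    by simp
qed

lemma true_gap_le:
  assumes "\<And>i. i \<in> {1..m} \<Longrightarrow> ereal (v i) \<le> gstar Y g i x"
  shows "(\<Sum>i\<in>{1..m}. ereal (g i x (y i)) - gstar Y g i x) \<le> ereal (\<Sum>i\<in>{1..m}. g i x (y i) - v i)"
proof -
  have "(\<Sum>i\<in>{1..m}. ereal (g i x (y i)) - gstar Y g i x) \<le> (\<Sum>i\<in>{1..m}. ereal (g i x (y i)) - ereal (v i))"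
    using assms by (intro sum_mono ereal_minus_mono) auto
  then show ?thesis
    by simp
qed

end

section \<open>The algorithm\<close>

locale algorithm_run = compact_disequilibrium +
  fixes YL1 :: "nat \<Rightarrow> point set"
    and e :: "nat \<Rightarrow> real" and \<eta> :: "nat \<Rightarrow> nat \<Rightarrow> real" and \<epsilon> :: real
  assumes YL1_subset: "\<And>i. i \<in> {1..m} \<Longrightarrow> YL1 i \<noteq> {} \<and> YL1 i \<subseteq> Y i"
    and e_nonneg: "\<And>k. k \<ge> 1 \<Longrightarrow> 0 \<le> e k"
    and eta_nonneg: "\<And>i k. i \<in> {1..m} \<Longrightarrow> k \<ge> 1 \<Longrightarrow> 0 \<le> \<eta> i k"
    and eps_large: "limsup (\<lambda>k. ereal (e k)) + 2 * (\<Sum>i\<in>{1..m}. limsup (\<lambda>k. ereal (\<eta> i k)))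
                    < ereal \<epsilon>"
begin

abbreviation "step \<equiv> iteration m Y g G \<epsilon> e \<eta>"

text \<open>
  The state invariant: the recorded bounds are valid, the upper one as a bound on the disequilibrium of
  the incumbent. An infinite upper bound is required as long as there is no incumbent, because this
  forces the first iteration to set one and the algorithm can never return \<open>None\<close>.
\<close>
fun sound :: "config \<Rightarrow> bool" where
  "sound (Running k YL dL dU inc) \<longleftrightarrow>
     1 \<le> k \<and> (\<forall>i\<in>{1..m}. YL i \<noteq> {} \<and> YL i \<subseteq> Y i) \<and> ereal dL \<le> \<delta> \<and>
     (case inc of None \<Rightarrow> dU = \<infinity>
      | Some (x, y) \<Rightarrow> (x, y) \<in> J \<and> (\<Sum>i\<in>{1..m}. ereal (g i x (y i)) - gstar Y g i x) \<le> dU)"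
| "sound (Returned r) \<longleftrightarrow> (\<exists>x y. r = Some (x, y) \<and> eps_optimal m Y g G \<epsilon> x y)"

lemma sound_initial: "sound (initial_config YL1)"
  using YL1_subset min_disequilibrium_nonneg by (simp add: initial_config_def zero_ereal_def)

lemma sound_step:
  assumes "step c c'" "sound c"
  shows "sound c'"
  using assms
proof (cases rule: iteration.cases)
  case (1 YL k x y w lb z gL dL dU inc)
  define ub where "ub = (\<Sum>i\<in>{1..m}. g i x (y i) - gL i)"
  define dL' where "dL' = max lb dL"
  define dU' where "dU' = min (ereal ub) dU"
  define inc' where "inc' = (if ereal ub < dU then Some (x, y) else inc)"
  have k: "1 \<le> k" and YL: "\<And>i. i \<in> {1..m} \<Longrightarrow> YL i \<noteq> {} \<and> YL i \<subseteq> Y i" and dL: "ereal dL \<le> \<delta>"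
    and inc: "case inc of None \<Rightarrow> dU = \<infinity>
      | Some (x, y) \<Rightarrow> (x, y) \<in> J \<and> (\<Sum>i\<in>{1..m}. ereal (g i x (y i)) - gstar Y g i x) \<le> dU"
    using assms(2) unfolding 1(1) by auto
  have xy: "(x, y) \<in> J" and lb: "ereal lb \<le> \<delta>"
    and near: "(\<Sum>i\<in>{1..m}. g i x (y i) - w i) \<le> lb + e k"
    using 1(3) lower_value_le[of YL] YL
    by (auto simp: lower_answer_def lower_feasible_def disequilibrium_def abs_le_iff intro: order_trans)
  have z: "z i \<in> Y i" and gL: "ereal (gL i) \<le> gstar Y g i x" if "i \<in> {1..m}" for i
    using 1(4) that by (auto simp: player_answer_def)
  have dL': "ereal dL' \<le> \<delta>"
    using lb dL by (simp add: dL'_def max_def)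
  have inc': "\<exists>x' y'. inc' = Some (x', y') \<and> (x', y') \<in> J \<and>
      (\<Sum>i\<in>{1..m}. ereal (g i x' (y' i)) - gstar Y g i x') \<le> dU'"
  proof (cases "ereal ub < dU")
    case True
    then show ?thesis
      using xy true_gap_le[of gL x y] gL by (simp add: inc'_def dU'_def ub_def min_absorb1 less_imp_le)
  next
    case False
    then have "dU \<noteq> \<infinity>" "dU' = dU"
      by (auto simp: dU'_def min_def)
    then show ?thesis
      using False inc by (auto simp: inc'_def split: option.splits)
  qed
  have next_eq: "c' = (if e k \<le> \<epsilon> \<and> (\<forall>i\<in>{1..m}. w i \<le> gL i) then Returned (Some (x, y))
      else if dU' - ereal dL' \<le> ereal \<epsilon> then Returned inc'
      else Running (Suc k) (\<lambda>i. YL i \<union> {z i}) dL' dU' inc')"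
    unfolding 1(2) next_config_def Let_def ub_def dL'_def dU'_def inc'_def by (rule refl)
  \<comment> \<open>The two stopping tests, and the passage to the next iteration.\<close>
  consider (accurate) "e k \<le> \<epsilon>" "\<forall>i\<in>{1..m}. w i \<le> gL i" "c' = Returned (Some (x, y))"
    | (closed) "dU' - ereal dL' \<le> ereal \<epsilon>" "c' = Returned inc'"
    | (continue) "c' = Running (Suc k) (\<lambda>i. YL i \<union> {z i}) dL' dU' inc'"
    using next_eq by (auto split: if_splits)
  then show ?thesis
  proof cases
    case accurate
    have "(\<Sum>i\<in>{1..m}. ereal (g i x (y i)) - gstar Y g i x) \<le> ereal (\<Sum>i\<in>{1..m}. g i x (y i) - w i)"
      using gL accurate(2) by (intro true_gap_le) (meson ereal_less_eq(3) order_trans)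
    also have "\<dots> \<le> ereal lb + ereal \<epsilon>"
      using near accurate(1) by simp
    also have "\<dots> \<le> \<delta> + ereal \<epsilon>"
      using lb by (rule add_right_mono)
    finally show ?thesis
      using xy joint_strategiesD by (simp add: accurate(3) eps_optimal_def)
  next
    case closed
    have "dU' \<le> ereal \<epsilon> + ereal dL'"
      using closed(1) by (simp add: ereal_minus_le)
    also have "\<dots> \<le> \<delta> + ereal \<epsilon>"
      using dL' by (metis add.commute add_right_mono)
    finally show ?thesis
      using inc' joint_strategiesD by (fastforce simp: closed(2) eps_optimal_def)
  next
    case continue
    then show ?thesis
      using k YL z dL' inc' by auto
  qed
qed

lemma running_progress:
  assumes "sound (Running k YL dL dU inc)"
  shows "\<exists>c'. step (Running k YL dL dU inc) c'"
proof -
  have k: "1 \<le> k" and YL: "\<And>i. i \<in> {1..m} \<Longrightarrow> YL i \<noteq> {} \<and> YL i \<subseteq> Y i"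
    using assms by auto
  obtain x y w lb where low: "lower_answer m Y g G YL (e k) (x, y, w) lb"
    using lower_solvable[of YL "e k"] YL e_nonneg[OF k] by blast
  then have "x \<in> topspace (Euclidean_space n0)"
    using joint_strategiesD(2) by (auto simp: lower_answer_def lower_feasible_def)
  then have "\<forall>i\<in>{1..m}. \<exists>z gL. player_answer Y g i x (\<eta> i k) z gL"
    using player_solvable YL eta_nonneg[OF _ k] by blast
  then obtain z gL where "\<forall>i\<in>{1..m}. player_answer Y g i x (\<eta> i k) (z i) (gL i)"
    by metis
  with low show ?thesis
    using iteration.intros by blast
qed

text \<open>
  The recorded bounds are at least as tight as the two bounds computed in the iteration itself. So
  termination can be argued from the answers of a single iteration, without the history of the bounds.
\<close>
lemma running_step:
  assumes "step (Running k YL dL dU inc) (Running k' YL' dL' dU' inc')"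
  obtains x y w lb z gL where "lower_answer m Y g G YL (e k) (x, y, w) lb"
    "\<And>i. i \<in> {1..m} \<Longrightarrow> player_answer Y g i x (\<eta> i k) (z i) (gL i)"
    "k' = Suc k" "\<And>i. YL' i = insert (z i) (YL i)"
    "\<epsilon> < (\<Sum>i\<in>{1..m}. g i x (y i) - gL i) - lb"
  using assms
proof (cases rule: iteration.cases)
  case (1 x y w lb z gL)
  define ub where "ub = (\<Sum>i\<in>{1..m}. g i x (y i) - gL i)"
  define M where "M = max lb dL"
  have nx: "k' = Suc k" "YL' = (\<lambda>i. YL i \<union> {z i})"
    "\<not> min (ereal ub) dU - ereal M \<le> ereal \<epsilon>"
    using 1(1) unfolding next_config_def Let_def ub_def M_def by (simp_all split: if_splits)
  have "ereal \<epsilon> + ereal M < ereal ub"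
    using nx(3) by (simp add: ereal_minus_le not_le)
  then have "\<epsilon> < ub - lb"
    unfolding M_def plus_ereal.simps less_ereal.simps by linarith
  then show thesis
    using that[of x y w lb z gL] 1(2,3) nx by (auto simp: ub_def)
qed

lemma tolerances_eventually_small:
  obtains b where "b < \<epsilon>" "\<forall>\<^sub>F k in sequentially. e k + (\<Sum>i\<in>{1..m}. \<eta> i k) < b"
proof -
  let ?H = "\<Sum>i\<in>{1..m}. limsup (\<lambda>k. ereal (\<eta> i k))"
  have "0 \<le> limsup (\<lambda>k. ereal (\<eta> i k))" if "i \<in> {1..m}" for i
    using eta_nonneg[OF that] by (intro le_Limsup) (auto simp: eventually_sequentially)
  then have "0 \<le> ?H"
    by (intro sum_nonneg) auto
  then have "?H \<le> 2 * ?H"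
    by (cases ?H) auto
  have "limsup (\<lambda>k. ereal (e k) + (\<Sum>i\<in>{1..m}. ereal (\<eta> i k)))
      \<le> limsup (\<lambda>k. ereal (e k)) + limsup (\<lambda>k. \<Sum>i\<in>{1..m}. ereal (\<eta> i k))"
    by (rule ereal_limsup_add_mono)
  also have "\<dots> \<le> limsup (\<lambda>k. ereal (e k)) + 2 * ?H"
    using limsup_sum_le[of "\<lambda>i k. ereal (\<eta> i k)"] \<open>?H \<le> 2 * ?H\<close>
    by (intro add_left_mono) (rule order_trans)
  also have "\<dots> < ereal \<epsilon>"
    by (rule eps_large)
  finally obtain b where b: "limsup (\<lambda>k. ereal (e k) + (\<Sum>i\<in>{1..m}. ereal (\<eta> i k))) < ereal b"
      "ereal b < ereal \<epsilon>"
    using ereal_dense2 by blast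
  have "\<forall>\<^sub>F k in sequentially. e k + (\<Sum>i\<in>{1..m}. \<eta> i k) < b"
    using Limsup_lessD[OF b(1)] by simp
  then show thesis
    using that b(2) by simp
qed

lemma no_infinite_run:
  assumes "c 0 = initial_config YL1" "\<And>j. step (c j) (c (Suc j))"
  shows False
proof -
  have "\<exists>YL dL dU inc. c j = Running (Suc j) YL dL dU inc" for j
  proof (induction j)
    case 0
    then show ?case
      using assms(1) by (simp add: initial_config_def)
  next
    case (Suc j)
    from assms(2)[of "Suc j"] obtain k' YL' dL' dU' inc' where "c (Suc j) = Running k' YL' dL' dU' inc'"
      by (auto elim: iteration.cases)
    then show ?case
      using Suc assms(2)[of j] by (auto elim: running_step)
  qed
  then obtain YL dL dU inc where c: "\<And>j. c j = Running (Suc j) (YL j) (dL j) (dU j) (inc j)"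
    by metis
  have "\<forall>j. \<exists>x y w lb z gL. lower_answer m Y g G (YL j) (e (Suc j)) (x, y, w) lb \<and>
      (\<forall>i\<in>{1..m}. player_answer Y g i x (\<eta> i (Suc j)) (z i) (gL i)) \<and>
      (\<forall>i. YL (Suc j) i = insert (z i) (YL j i)) \<and>
      \<epsilon> < (\<Sum>i\<in>{1..m}. g i x (y i) - gL i) - lb"
  proof
    fix j
    show "\<exists>x y w lb z gL. lower_answer m Y g G (YL j) (e (Suc j)) (x, y, w) lb \<and>
      (\<forall>i\<in>{1..m}. player_answer Y g i x (\<eta> i (Suc j)) (z i) (gL i)) \<and>
      (\<forall>i. YL (Suc j) i = insert (z i) (YL j i)) \<and>
      \<epsilon> < (\<Sum>i\<in>{1..m}. g i x (y i) - gL i) - lb"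
      by (rule running_step[OF assms(2)[of j, unfolded c]]) blast
  qed
  then obtain x y w lb z gL where
    low: "\<And>j. lower_answer m Y g G (YL j) (e (Suc j)) (x j, y j, w j) (lb j)" and
    player: "\<And>j i. i \<in> {1..m} \<Longrightarrow> player_answer Y g i (x j) (\<eta> i (Suc j)) (z j i) (gL j i)" and
    YL_Suc: "\<And>j i. YL (Suc j) i = insert (z j i) (YL j i)" and
    gap: "\<And>j. \<epsilon> < (\<Sum>i\<in>{1..m}. g i (x j) (y j i) - gL j i) - lb j"
    unfolding choice_iff by blast
  have xJ: "x j \<in> fst ` J" for j
    using low[of j] by (force simp: lower_answer_def lower_feasible_def)
  \<comment> \<open>All earlier answers are cuts of the current lower bounding problem.\<close>
  have collected: "z j i \<in> YL l i" if "j < l" for j l i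
    using that by (induction l) (auto simp: YL_Suc less_Suc_eq)
  obtain b where b: "b < \<epsilon>" "\<forall>\<^sub>F k in sequentially. e k + (\<Sum>i\<in>{1..m}. \<eta> i k) < b"
    using tolerances_eventually_small by blast
  \<comment> \<open>The inaccuracy to be reached for each player, chosen so that \<open>m\<close> of them fit between \<open>b\<close> and \<open>\<epsilon>\<close>.\<close>
  define s where "s = (\<epsilon> - b) / (real m + 1)"
  have s: "0 < s" "b + real m * s < \<epsilon>"
    using b(1) by (auto simp: s_def field_simps)
  have "\<forall>\<^sub>F l in sequentially. w l i \<le> g i (x l) (z l i) + s" if i: "i \<in> {1..m}" for i
  proof (rule discretization_eventually_accurate[where f = "g i" and x = x and z = "\<lambda>l. z l i"
        and w = "\<lambda>l. w l i", OF compact_leader Y_props(1)[OF i]])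
    show "continuous_on (fst ` J \<times> Y i) (\<lambda>(x, z). g i x z)"
      using g_continuous_on[OF i] by (rule continuous_on_subset) (auto dest: joint_strategiesD(2))
    show "z k i \<in> Y i" for k
      using player[OF i] by (simp add: player_answer_def)
    show "w l i \<le> g i (x l) (z k i)" if "k < l" for k l
      using low[of l] collected[OF that] i by (simp add: lower_answer_def lower_feasible_def)
  qed (fact xJ s(1))+
  then have "\<forall>\<^sub>F l in sequentially. \<forall>i\<in>{1..m}. w l i \<le> g i (x l) (z l i) + s"
    by (simp add: eventually_ball_finite)
  moreover have "\<forall>\<^sub>F l in sequentially. e (Suc l) + (\<Sum>i\<in>{1..m}. \<eta> i (Suc l)) < b"
    using b(2) eventually_sequentially_Suc[of "\<lambda>k. e k + (\<Sum>i\<in>{1..m}. \<eta> i k) < b"] by simp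
  ultimately have "\<forall>\<^sub>F l in sequentially. (\<forall>i\<in>{1..m}. w l i \<le> g i (x l) (z l i) + s) \<and>
      e (Suc l) + (\<Sum>i\<in>{1..m}. \<eta> i (Suc l)) < b"
    by (rule eventually_conj)
  then obtain l where acc: "\<And>i. i \<in> {1..m} \<Longrightarrow> w l i \<le> g i (x l) (z l i) + s"
    and tol: "e (Suc l) + (\<Sum>i\<in>{1..m}. \<eta> i (Suc l)) < b"
    using eventually_happens'[OF sequentially_bot] by blast
  \<comment> \<open>In iteration \<open>Suc l\<close> the terms \<open>g i x (y i)\<close> cancel between the two bounds.\<close>
  have "(\<Sum>i\<in>{1..m}. g i (x l) (y l i) - w l i) \<le> lb l + e (Suc l)"
    using low[of l] by (auto simp: lower_answer_def disequilibrium_def abs_le_iff)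
  then have "\<epsilon> < e (Suc l) + (\<Sum>i\<in>{1..m}. w l i - gL l i)"
    using gap[of l] by (simp add: sum_subtractf)
  also have "(\<Sum>i\<in>{1..m}. w l i - gL l i) \<le> (\<Sum>i\<in>{1..m}. \<eta> i (Suc l) + s)"
    using acc player[of _ l] by (intro sum_mono) (force simp: player_answer_def)
  also have "e (Suc l) + (\<Sum>i\<in>{1..m}. \<eta> i (Suc l) + s) < b + real m * s"
    using tol by (simp add: sum.distrib)
  finally show False
    using s(2) by simp
qed

end

theorem theorem1:
  fixes m n0 :: nat and n :: "nat \<Rightarrow> nat"
    and Y :: "nat \<Rightarrow> point set"
    and g :: "nat \<Rightarrow> point \<Rightarrow> point \<Rightarrow> real"
    and G :: "(point \<times> profile) set"
    and YL1 :: "nat \<Rightarrow> point set"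
    and e :: "nat \<Rightarrow> real" and \<eta> :: "nat \<Rightarrow> nat \<Rightarrow> real" and \<epsilon> :: real
  assumes G_subset: "G \<subseteq> topspace (Euclidean_space n0) \<times>
                          (\<Pi>\<^sub>E i\<in>{1..m}. topspace (Euclidean_space (n i)))"
    and joint_compact:
      "compactin (prod_topology (Euclidean_space n0)
                   (product_topology (\<lambda>i. Euclidean_space (n i)) {1..m}))
                 (joint_strategies m Y G)"
    and joint_nonempty: "joint_strategies m Y G \<noteq> {}"
    and Y_compact: "\<And>i. i \<in> {1..m} \<Longrightarrow> compactin (Euclidean_space (n i)) (Y i)"
    and g_continuous:
      "\<And>i. i \<in> {1..m} \<Longrightarrow>
         continuous_map (prod_topology (Euclidean_space n0)
                           (subtopology (Euclidean_space (n i)) (Y i)))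
                        euclideanreal (\<lambda>(x, z). g i x z)"
    and YL1_subset: "\<And>i. i \<in> {1..m} \<Longrightarrow> YL1 i \<noteq> {} \<and> YL1 i \<subseteq> Y i"
    and e_nonneg: "\<And>k. k \<ge> 1 \<Longrightarrow> 0 \<le> e k"
    and eta_nonneg: "\<And>i k. i \<in> {1..m} \<Longrightarrow> k \<ge> 1 \<Longrightarrow> 0 \<le> \<eta> i k"
    and eps_pos: "0 < \<epsilon>"
    and eps_large: "limsup (\<lambda>k. ereal (e k)) + 2 * (\<Sum>i\<in>{1..m}. limsup (\<lambda>k. ereal (\<eta> i k)))
                    < ereal \<epsilon>"
  shows "terminates_returning (iteration m Y g G \<epsilon> e \<eta>) (initial_config YL1)
           (eps_optimal m Y g G \<epsilon>)"
proof -
  interpret algorithm_run m n0 n Y g G YL1 e \<eta> \<epsilon>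
    by unfold_locales (fact assms)+
  have reach: "sound c" if "step\<^sup>*\<^sup>* (initial_config YL1) c" for c
    using that by induction (auto intro: sound_initial sound_step)
  have "\<exists>x y. c = Returned (Some (x, y)) \<and> eps_optimal m Y g G \<epsilon> x y"
    if "step\<^sup>*\<^sup>* (initial_config YL1) c" "\<nexists>c'. step c c'" for c
    using reach[OF that(1)] that(2) running_progress by (cases c) auto
  then show ?thesis
    unfolding terminates_returning_def using no_infinite_run by blast
qed

end
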